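(* Let $\sigma$ and $\varphi$ be as in the context. For any $s\in[0,T]$, $\zeta\in\mathbb R^d$, $y\in\mathbb R$, $\bar x\in\mathbb R^n$, there exists a unique $z\in\mathbb R^d$ such that $$z=\zeta+D\varphi(s,\bar x).\sigma(s,\bar x,y+\varphi(s,\bar x),z).$$ That is, the solution $z$ can be written as $z=h(s,\bar x,y,\zeta)$, where the function $h$ is Lipschitz with respect to $(y,\zeta)$ and $|h(s,\bar x,y,\zeta)|\le C(1+|\bar x|+|y|+|\zeta|)$, with the constant $C$ independent of $s,\bar x,y,\zeta$. Moreover $z=h(s,\bar x,y,\zeta)$ is continuous with respect to $s$.
   Context: $\sigma:[0,T]\times\mathbb R^n\times\mathbb R\times\mathbb R^d\to\mathbb R^{n\times d}$ is a deterministic map, continuous in $s$, which is the diffusion coefficient (not depending on the control) of a fully coupled controlled FBSDE with coefficients $b:[0,T]\times\mathbb R^n\times\mathbb R\times\mathbb R^d\times U\to\mathbb R^n$, $f:[0,T]\times\mathbb R^n\times\mathbb R\times\mathbb R^d\times U\to\mathbb R$, where $U$ is a compact metric space and $b,f$ are continuous in $(t,u)$. $G$ is a fixed full-rank $1\times n$ matrix. The assumptions are: (Lipschitz) there is $K\ge0$ with $|l(s,x_1,y_1,z_1,u)-l(s,x_2,y_2,z_2,u)|\le K(|x_1-x_2|+|y_1-y_2|+|z_1-z_2|)$ for $l=b,\sigma,f$ and all arguments. (Monotonicity) with $\lambda=(x,y,z)$ and $A(s,\lambda,u)=(-G^Tf,Gb,G\sigma)(s,\lambda,u)$, $\langle A(s,\lambda,u)-A(s,\bar\lambda,u),\lambda-\bar\lambda\rangle\le-\beta_1|G(x-\bar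 x)|^2-\beta_2(|G^T(y-\bar y)|^2+|G^T(z-\bar z)|^2)$ for all $s,u,\lambda,\bar\lambda$, where $\beta_1\ge0$ and $\beta_2>0$. (In particular $\langle G\sigma(s,x,y,z)-G\sigma(s,x,y,\bar z),z-\bar z\rangle\le-\beta_2|G^T(z-\bar z)|^2$.) (Uniform continuity in time) $G\sigma(s,x,y,z)$ is continuous in $s$, uniformly with respect to $(x,y,z)\in\mathbb R^n\times\mathbb R\times\mathbb R^d$. $\varphi\in C^3_{l,b}([0,T]\times\mathbb R^n)$ (continuously differentiable up to third order with bounded derivatives of orders 1 to 3) satisfies $\langle\varphi(s,x)-\varphi(s,\bar x),G(x-\bar x)\rangle\ge0$ for all $s,x,\bar x$. $D\varphi$ is the spatial gradient (a row vector), so $D\varphi.\sigma\in\mathbb R^d$. *)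

theory Defs
  imports "HOL-Analysis.Analysis"
begin

text \<open>
  The class of functions on S that are three times continuously differentiable with bounded
  derivatives of orders 1 to 3 (the function itself need not be bounded). Derivatives are
  Frechet derivatives within S, hence one-sided at boundary points of S.
\<close>

definition C3_lb_on :: "'a::real_normed_vector set \<Rightarrow> ('a \<Rightarrow> real) \<Rightarrow> bool" where
  "C3_lb_on S g \<longleftrightarrow>
    (\<exists>(D1 :: 'a \<Rightarrow> 'a \<Rightarrow>\<^sub>L real) (D2 :: 'a \<Rightarrow> 'a \<Rightarrow>\<^sub>L 'a \<Rightarrow>\<^sub>L real)
      (D3 :: 'a \<Rightarrow> 'a \<Rightarrow>\<^sub>L 'a \<Rightarrow>\<^sub>L 'a \<Rightarrow>\<^sub>L real).
      (\<forall>p\<in>S. (g has_derivative blinfun_apply (D1 p)) (at p within S)) \<and>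
      (\<forall>p\<in>S. (D1 has_derivative blinfun_apply (D2 p)) (at p within S)) \<and>
      (\<forall>p\<in>S. (D2 has_derivative blinfun_apply (D3 p)) (at p within S)) \<and>
      continuous_on S D3 \<and>
      bounded (D1 ` S) \<and> bounded (D2 ` S) \<and> bounded (D3 ` S))"

definition spatial_gradient :: "(real \<Rightarrow> real^'n \<Rightarrow> real) \<Rightarrow> real \<Rightarrow> real^'n \<Rightarrow> real^'n" where
  "spatial_gradient \<phi> s x = (\<chi> i. frechet_derivative (\<phi> s) (at x) (axis i 1))"

text \<open>
  The map A = (-G^T f, G b, G sigma). The real number f is turned into a vector of length 1 by
  vec, and the 1-row results G b and G sigma are read as a real number and as an element of
  R^d by taking their row 1. In the same way vec z, for z in R^d, is the 1 x d matrix with row z.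
\<close>

definition monotonicity_map ::
  "real^'n^1 \<Rightarrow> (real \<Rightarrow> real^'n \<Rightarrow> real \<Rightarrow> real^'d \<Rightarrow> 'u \<Rightarrow> real^'n) \<Rightarrow>
   (real \<Rightarrow> real^'n \<Rightarrow> real \<Rightarrow> real^'d \<Rightarrow> real^'d^'n) \<Rightarrow>
   (real \<Rightarrow> real^'n \<Rightarrow> real \<Rightarrow> real^'d \<Rightarrow> 'u \<Rightarrow> real) \<Rightarrow>
   real \<Rightarrow> (real^'n) \<times> real \<times> (real^'d) \<Rightarrow> 'u \<Rightarrow> (real^'n) \<times> real \<times> (real^'d)" where
  "monotonicity_map G b \<sigma> f s = (\<lambda>(x, y, z) u.
     (- (transpose G *v vec (f s x y z u)), (G *v b s x y z u) $ 1, (G ** \<sigma> s x y z) $ 1))"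

end

theory Submission
  imports Defs
begin

text \<open>
  Write \<open>g\<close> for the only row of \<open>G\<close>. Since \<open>\<phi>(s, \<cdot>)\<close> can only grow when \<open>g \<bullet> x\<close> grows and only
  decrease when it decreases, its gradient is \<open>\<alpha> g\<close> with a scalar \<open>\<alpha> \<ge> 0\<close>
  (\<open>derivative_parallel_if_monotone_along\<close>). This is where the two monotonicity assumptions
  meet: the perturbation \<open>N z = D\<phi> \<sigma>(z) = \<alpha> G\<sigma>(z)\<close> in the equation \<open>z = \<zeta> + N z\<close> is a
  nonnegative multiple of \<open>G\<sigma>\<close>, which is dissipative in \<open>z\<close> by the monotonicity condition with
  equal \<open>x\<close> and \<open>y\<close>. Hence \<open>N\<close> is dissipative and Lipschitz, although not a contraction.

  For such \<open>N\<close> the equation has exactly one solution, by Banach's theorem applied to a damped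
  iteration (\<open>dissipative_lipschitz_unique_fixpoint\<close>). Dissipativity also gives
  \<open>|z - z'| \<le> |(z - N z) - (z' - N z')|\<close>, so the distance of any \<open>z\<close> from the solution is at
  most its defect \<open>|\<zeta> + N z - z|\<close>, whatever the size of the Lipschitz constant. The remaining
  claims follow by choosing the comparison point \<open>z\<close>: the solution for other data \<open>(y', \<zeta>')\<close> for
  the Lipschitz property, \<open>0\<close> for the growth bound, and the solution at time \<open>s\<close> in the equation
  at time \<open>r \<rightarrow> s\<close> for continuity in time.
\<close>

section \<open>Norm and inner product of vector-matrix products\<close>

lemma vector_matrix_mult_eq_sum_rows:
  fixes v :: "real^'n" and A :: "real^'d^'n"
  shows "v v* A = (\<Sum>i\<in>UNIV. v $ i *\<^sub>R A $ i)"
  by (simp add: vec_eq_iff vector_matrix_mult_def mult.commute)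

lemma norm_vector_matrix_mult_le:
  fixes v :: "real^'n" and A :: "real^'d^'n"
  shows "norm (v v* A) \<le> norm v * norm A"
proof -
  have "norm (v v* A) \<le> (\<Sum>i\<in>UNIV. norm (v $ i *\<^sub>R A $ i))"
    unfolding vector_matrix_mult_eq_sum_rows by (rule norm_sum)
  also have "\<dots> = (\<Sum>i\<in>UNIV. \<bar>norm (v $ i)\<bar> * \<bar>norm (A $ i)\<bar>)"
    by simp
  also have "\<dots> \<le> L2_set (\<lambda>i. norm (v $ i)) UNIV * L2_set (\<lambda>i. norm (A $ i)) UNIV"
    by (rule L2_set_mult_ineq)
  finally show ?thesis
    by (simp add: norm_vec_def)
qed

lemma continuous_on_vector_matrix_mult:
  fixes v :: "'a::topological_space \<Rightarrow> real^'n" and A :: "'a \<Rightarrow> real^'d^'n"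
  assumes "continuous_on S v" "continuous_on S A"
  shows "continuous_on S (\<lambda>r. v r v* A r)"
  unfolding vector_matrix_mult_eq_sum_rows by (intro continuous_intros assms)

lemma matrix_matrix_mult_row:
  fixes G :: "real^'n^'m" and A :: "real^'d^'n"
  shows "(G ** A) $ k = G $ k v* A"
  by (simp add: vec_eq_iff matrix_matrix_mult_def vector_matrix_mult_def mult.commute)

section \<open>Perturbing the identity by a dissipative map\<close>

text \<open>
  Expanding the square of \<^term>\<open>d - e\<close>, the cross term has the favourable sign. Applied to
  increments of arguments and values of a dissipative map \<open>N\<close>, this says that the identity
  minus \<open>N\<close> does not contract distances. All quantitative statements about
  the implicit function are instances of it.
\<close>

lemma norm_le_norm_diff_if_inner_nonpos:
  fixes d e :: "'a::real_inner"
  assumes "e \<bullet> d \<le> 0"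
  shows "norm d \<le> norm (d - e)"
proof -
  have "2 * (e \<bullet> d) \<le> e \<bullet> e"
    using assms inner_ge_zero[of e] by linarith
  then have "(norm d)\<^sup>2 \<le> (norm (d - e))\<^sup>2"
    by (simp add: power2_norm_eq_inner inner_diff inner_commute)
  then show ?thesis
    by (rule power2_le_imp_le) simp
qed

text \<open>
  The Lipschitz constant of \<open>N\<close> may be large, so \<open>z \<mapsto> c + N z\<close> need not be a contraction. The
  remedy is damping: \<open>z \<mapsto> z - \<rho> (z - c - N z)\<close> has the same fixed points. If \<open>d\<close> and \<open>e\<close>
  are increments of \<open>z\<close> and \<open>z - N z\<close>, the squared increment of the damped map is
  \<open>|d - \<rho> e|\<^sup>2 = |d|\<^sup>2 - 2 \<rho> (e \<bullet> d) + \<rho>\<^sup>2 |e|\<^sup>2\<close>, where dissipativity gives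
  \<open>e \<bullet> d \<ge> |d|\<^sup>2\<close>. For small \<open>\<rho>\<close> the linear term beats the quadratic one.
\<close>

lemma dissipative_lipschitz_unique_fixpoint:
  fixes N :: "'a::{real_inner, complete_space} \<Rightarrow> 'a"
  assumes diss: "\<And>z z'. (N z - N z') \<bullet> (z - z') \<le> 0"
    and lip: "\<And>z z'. norm (N z - N z') \<le> L * norm (z - z')"
    and "L \<ge> 0"
  shows "\<exists>!z. z = c + N z"
proof -
  define M where "M = 1 + L"
  \<comment> \<open>The choice that minimises \<open>1 - 2 \<rho> + \<rho>\<^sup>2 M\<^sup>2\<close>, the squared contraction factor.\<close>
  define \<rho> where "\<rho> = 1 / M\<^sup>2"
  define P where "P z = z - \<rho> *\<^sub>R (z - c - N z)" for z
  have M: "M \<ge> 1"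
    using \<open>L \<ge> 0\<close> by (simp add: M_def)
  then have \<rho>: "0 < \<rho>" "\<rho> \<le> 1" and \<rho>M: "\<rho>\<^sup>2 * M\<^sup>2 = \<rho>"
    by (auto simp: \<rho>_def power2_eq_square divide_simps mult_ge1_I)
  have contraction: "norm (P z - P z') \<le> sqrt (1 - \<rho>) * norm (z - z')" for z z'
  proof -
    define d where "d = z - z'"
    define e where "e = d - (N z - N z')"
    have ed: "e \<bullet> d \<ge> (norm d)\<^sup>2"
      using diss[of z z'] by (simp add: e_def d_def inner_diff_left power2_norm_eq_inner)
    have "norm e \<le> norm d + norm (N z - N z')"
      unfolding e_def by (rule norm_triangle_ineq4)
    also have "\<dots> \<le> M * norm d"
      using lip[of z z'] by (simp add: M_def d_def algebra_simps)
    finally have "(norm e)\<^sup>2 \<le> (M * norm d)\<^sup>2"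
      by (intro power_mono) auto
    then have "\<rho>\<^sup>2 * (norm e)\<^sup>2 \<le> \<rho>\<^sup>2 * (M * norm d)\<^sup>2"
      by (intro mult_left_mono) auto
    also have "\<dots> = \<rho> * (norm d)\<^sup>2"
      using \<rho>M by (simp add: power_mult_distrib mult.assoc[symmetric])
    finally have e2: "\<rho>\<^sup>2 * (norm e)\<^sup>2 \<le> \<rho> * (norm d)\<^sup>2" .
    have "P z - P z' = d - \<rho> *\<^sub>R e"
      by (simp add: P_def d_def e_def algebra_simps)
    then have "(norm (P z - P z'))\<^sup>2 = (norm (d - \<rho> *\<^sub>R e))\<^sup>2"
      by simp
    also have "\<dots> = (norm d)\<^sup>2 - 2 * (\<rho> * (e \<bullet> d)) + \<rho>\<^sup>2 * (norm e)\<^sup>2"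
      unfolding power2_norm_eq_inner
      by (simp add: inner_diff inner_commute power2_eq_square algebra_simps)
    also have "\<dots> \<le> (norm d)\<^sup>2 - 2 * (\<rho> * (norm d)\<^sup>2) + \<rho> * (norm d)\<^sup>2"
      using e2 mult_left_mono[OF ed less_imp_le[OF \<rho>(1)]] by linarith
    also have "\<dots> = (sqrt (1 - \<rho>) * norm d)\<^sup>2"
      using \<rho>(2) by (simp add: power_mult_distrib algebra_simps)
    finally show ?thesis
      unfolding d_def[symmetric] by (rule power2_le_imp_le) (use \<rho>(2) in simp)
  qed
  have "\<exists>!z. P z = z"
    by (rule banach_fix_type[of "sqrt (1 - \<rho>)"]) (use \<rho> contraction in \<open>auto simp: dist_norm\<close>)
  moreover have "P z = z \<longleftrightarrow> z = c + N z" for z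
    using \<rho>(1) by (simp add: P_def diff_diff_eq)
  ultimately show ?thesis
    by simp
qed

section \<open>Functions that are monotone along a linear functional\<close>

text \<open>
  First \<open>D v * (g \<bullet> v) \<ge> 0\<close> for every direction \<open>v\<close>, as a limit of scaled increments along
  \<open>v\<close>. Moving from a direction \<open>w\<close> orthogonal to \<open>g\<close> to \<open>w + t g\<close>, this becomes
  \<open>t (D w + t D g) \<ge> 0\<close> for all real \<open>t\<close>; small \<open>t\<close> of sign opposite to \<open>D w\<close> would
  violate this unless \<open>D w = 0\<close>. So \<open>D\<close>
  vanishes on the orthogonal complement of \<open>g\<close> and is nonnegative at \<open>g\<close>.
\<close>

lemma derivative_parallel_if_monotone_along:
  fixes \<psi> :: "'a::real_inner \<Rightarrow> real"
  assumes der: "(\<psi> has_derivative D) (at x)"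
    and mono: "\<And>x'. (\<psi> x' - \<psi> x) * (g \<bullet> (x' - x)) \<ge> 0"
    and "g \<noteq> 0"
  obtains \<alpha> where "\<alpha> \<ge> 0" "\<And>v. D v = \<alpha> * (g \<bullet> v)"
proof -
  interpret D: bounded_linear D
    by (rule has_derivative_bounded_linear[OF der])
  have dir: "D v * (g \<bullet> v) \<ge> 0" for v
  proof -
    have "((\<lambda>t. x + t *\<^sub>R v) has_derivative (\<lambda>t. t *\<^sub>R v)) (at 0)"
      by (auto intro!: derivative_eq_intros)
    moreover have "(\<psi> has_derivative D) (at (x + 0 *\<^sub>R v))"
      using der by simp
    ultimately have "((\<lambda>t. \<psi> (x + t *\<^sub>R v)) has_derivative (\<lambda>t. D (t *\<^sub>R v))) (at 0)"
      by (rule has_derivative_compose)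
    moreover have "(\<lambda>t. D (t *\<^sub>R v)) = (*) (D v)"
      by (simp add: fun_eq_iff D.scaleR)
    ultimately have "((\<lambda>t. \<psi> (x + t *\<^sub>R v)) has_real_derivative D v) (at 0)"
      by (simp add: has_field_derivative_def)
    then have "((\<lambda>t. (\<psi> (x + t *\<^sub>R v) - \<psi> x) / t * (g \<bullet> v)) \<longlongrightarrow> D v * (g \<bullet> v)) (at 0)"
      unfolding DERIV_def by (intro tendsto_mult_right) simp
    moreover have "\<forall>\<^sub>F t in at 0. (\<psi> (x + t *\<^sub>R v) - \<psi> x) / t * (g \<bullet> v) \<ge> 0"
      unfolding eventually_at_filter
    proof (intro always_eventually allI impI)
      fix t :: real
      assume "t \<noteq> 0"
      then have "(\<psi> (x + t *\<^sub>R v) - \<psi> x) / t * (g \<bullet> v)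
          = ((\<psi> (x + t *\<^sub>R v) - \<psi> x) * (g \<bullet> (x + t *\<^sub>R v - x))) / t\<^sup>2"
        by (simp add: power2_eq_square field_simps)
      then show "(\<psi> (x + t *\<^sub>R v) - \<psi> x) / t * (g \<bullet> v) \<ge> 0"
        using mono[of "x + t *\<^sub>R v"] by simp
    qed
    ultimately show ?thesis
      by (rule tendsto_lowerbound) simp
  qed
  have gg: "g \<bullet> g > 0"
    using \<open>g \<noteq> 0\<close> by simp
  have Dg: "D g \<ge> 0"
    using dir[of g] gg by (simp add: zero_le_mult_iff)
  have orth: "D w = 0" if "g \<bullet> w = 0" for w
  proof (rule ccontr)
    assume "D w \<noteq> 0"
    \<comment> \<open>Chosen so that \<open>D w + t D g = - t\<close>, and the expression becomes \<open>- t\<^sup>2\<close>.\<close>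
    define t where "t = - D w / (1 + D g)"
    have "((D w + t * D g) * t) * (g \<bullet> g) \<ge> 0"
      using dir[of "w + t *\<^sub>R g"] that
      by (simp add: D.add D.scaleR inner_add_right mult.assoc)
    then have "(D w + t * D g) * t \<ge> 0"
      using gg by (meson mult_neg_pos not_le)
    moreover have "D w + t * D g = - t"
      using Dg by (simp add: t_def field_simps add_nonneg_eq_0_iff)
    ultimately have "t = 0"
      by (auto simp: mult_le_0_iff)
    then show False
      using \<open>D w \<noteq> 0\<close> Dg by (simp add: t_def)
  qed
  show thesis
  proof
    show "D g / (g \<bullet> g) \<ge> 0"
      using Dg gg by simp
    show "D v = D g / (g \<bullet> g) * (g \<bullet> v)" for v
    proof -
      have "D (v - ((g \<bullet> v) / (g \<bullet> g)) *\<^sub>R g) = 0"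
        using gg by (intro orth) (simp add: inner_diff_right)
      then show ?thesis
        by (simp add: D.diff D.scaleR)
    qed
  qed
qed

section \<open>The spatial gradient of a function with bounded derivatives\<close>

lemma linear_eq_inner_axis_values:
  fixes D :: "real^'n \<Rightarrow> real"
  assumes "linear D"
  shows "D v = (\<chi> i. D (axis i 1)) \<bullet> v"
proof -
  have "D v = D (\<Sum>i\<in>UNIV. v $ i *\<^sub>R axis i 1)"
    using basis_expansion[of v] by (simp add: scalar_mult_eq_scaleR)
  then show ?thesis
    using assms by (simp add: linear_sum linear_scale inner_vec_def mult.commute)
qed

text \<open>
  The derivative in space-time is one-sided in time at both ends of the interval, but
  restricted to a time slice it is a genuine derivative in space. Its representing vector
  inherits the bound of the space-time derivative and, as that one is differentiable, its
  continuity in time. The linear growth of \<open>\<phi>\<close> is the mean value inequality on the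
  convex set \<open>[0,T] \<times> \<real>\<^sup>n\<close>.
\<close>

lemma C3_lb_on_spatial_gradient:
  fixes \<phi> :: "real \<Rightarrow> real^'n \<Rightarrow> real"
  assumes C3: "C3_lb_on ({0..T} \<times> UNIV) (\<lambda>(s, x). \<phi> s x)"
  obtains B where "B \<ge> 0"
    and "\<And>s x. s \<in> {0..T} \<Longrightarrow> (\<phi> s has_derivative (\<lambda>v. spatial_gradient \<phi> s x \<bullet> v)) (at x)"
    and "\<And>s x. s \<in> {0..T} \<Longrightarrow> norm (spatial_gradient \<phi> s x) \<le> B"
    and "\<And>s x. s \<in> {0..T} \<Longrightarrow> \<bar>\<phi> s x\<bar> \<le> \<bar>\<phi> 0 0\<bar> + B * (T + norm x)"
    and "\<And>x. continuous_on {0..T} (\<lambda>s. \<phi> s x)"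
    and "\<And>x. continuous_on {0..T} (\<lambda>s. spatial_gradient \<phi> s x)"
proof -
  let ?S = "{0..T} \<times> (UNIV :: (real^'n) set)"
  obtain D1 D2 where
    D1: "\<And>p. p \<in> ?S \<Longrightarrow> ((\<lambda>(s, x). \<phi> s x) has_derivative blinfun_apply (D1 p)) (at p within ?S)"
    and D2: "\<And>p. p \<in> ?S \<Longrightarrow> (D1 has_derivative blinfun_apply (D2 p)) (at p within ?S)"
    and "bounded (D1 ` ?S)"
    using C3 unfolding C3_lb_on_def by metis
  then obtain B where "B > 0" and B: "\<And>p. p \<in> ?S \<Longrightarrow> norm (D1 p) \<le> B"
    unfolding bounded_pos by blast
  have slice: "(\<phi> s has_derivative (\<lambda>v. blinfun_apply (D1 (s, x)) (0, v))) (at x)"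
    if "s \<in> {0..T}" for s x
  proof -
    have "((\<lambda>x. (s, x)) has_derivative (\<lambda>v. (0, v))) (at x)"
      by (auto intro!: derivative_eq_intros)
    moreover have "range (Pair s) \<subseteq> ?S"
      using that by auto
    ultimately show ?thesis
      using has_derivative_in_compose2[OF D1, of "Pair s" UNIV x] by simp
  qed
  have grad_nth: "spatial_gradient \<phi> s x $ i = blinfun_apply (D1 (s, x)) (0, axis i 1)"
    if "s \<in> {0..T}" for s x i
    using frechet_derivative_at[OF slice[OF that]]
    by (simp add: spatial_gradient_def fun_eq_iff)
  have grad: "blinfun_apply (D1 (s, x)) (0, v) = spatial_gradient \<phi> s x \<bullet> v"
    if "s \<in> {0..T}" for s x v
  proof -
    have vec: "(\<chi> i. blinfun_apply (D1 (s, x)) (0, axis i 1)) = spatial_gradient \<phi> s x"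
      using grad_nth[OF that] by (simp add: vec_eq_iff)
    show ?thesis
      using linear_eq_inner_axis_values[OF has_derivative_linear[OF slice[OF that]], of x v]
      unfolding vec .
  qed
  have grad_bound: "norm (spatial_gradient \<phi> s x) \<le> B" if "s \<in> {0..T}" for s x
  proof -
    let ?p = "spatial_gradient \<phi> s x"
    have "norm ?p * norm ?p = blinfun_apply (D1 (s, x)) (0, ?p)"
      using grad[OF that] by (simp add: norm_eq_sqrt_inner)
    also have "\<dots> \<le> norm (D1 (s, x)) * norm (0 :: real, ?p)"
      using norm_blinfun[of "D1 (s, x)" "(0, ?p)"] by simp
    also have "\<dots> \<le> B * norm ?p"
      using B[of "(s, x)"] that by (simp add: norm_Pair mult_right_mono)
    finally show ?thesis
      using \<open>B > 0\<close> by (cases "norm ?p = 0") auto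
  qed
  have growth: "\<bar>\<phi> s x\<bar> \<le> \<bar>\<phi> 0 0\<bar> + B * (T + norm x)" if "s \<in> {0..T}" for s x
  proof -
    have "norm ((\<lambda>(s, x). \<phi> s x) (s, x) - (\<lambda>(s, x). \<phi> s x) (0, 0)) \<le> B * norm ((s, x) - (0, 0))"
      using that
      by (intro differentiable_bound[where S = ?S, OF _ D1])
        (auto intro: convex_Times B simp: norm_blinfun.rep_eq[symmetric])
    also have "\<dots> \<le> B * (T + norm x)"
    proof (rule mult_left_mono)
      have "norm (s, x) \<le> norm s + norm x"
        by (rule norm_Pair_le)
      then show "norm ((s, x) - (0, 0)) \<le> T + norm x"
        using that by simp
    qed (use \<open>B > 0\<close> in simp)
    finally show ?thesis
      by simp
  qed
  have pair: "continuous_on {0..T} (\<lambda>s. (s, x))" for x :: "real^'n"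
    by (intro continuous_intros)
  have cont_\<phi>: "continuous_on {0..T} (\<lambda>s. \<phi> s x)" for x
    using continuous_on_compose2[OF has_derivative_continuous_on[OF D1] pair[of x]] by auto
  have cont_D1: "continuous_on {0..T} (\<lambda>s. D1 (s, x))" for x
    using continuous_on_compose2[OF has_derivative_continuous_on[OF D2] pair[of x]] by auto
  have "continuous_on {0..T} (\<lambda>s. \<chi> i. blinfun_apply (D1 (s, x)) (0, axis i 1))" for x
    by (intro continuous_intros cont_D1)
  then have cont_grad: "continuous_on {0..T} (\<lambda>s. spatial_gradient \<phi> s x)" for x
    by (rule continuous_on_eq[of _ "\<lambda>s. \<chi> i. blinfun_apply (D1 (s, x)) (0, axis i 1)"])
      (simp add: vec_eq_iff grad_nth)
  show thesis
    using that[of B] \<open>B > 0\<close> slice grad grad_bound growth cont_\<phi> cont_grad by simp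
qed

section \<open>The implicit equation\<close>

theorem proposition4p1:
  fixes T K \<beta>\<^sub>1 \<beta>\<^sub>2 :: real
    and U :: "'u::metric_space set"
    and G :: "real^'n^1"
    and b :: "real \<Rightarrow> real^'n \<Rightarrow> real \<Rightarrow> real^'d \<Rightarrow> 'u \<Rightarrow> real^'n"
    and \<sigma> :: "real \<Rightarrow> real^'n \<Rightarrow> real \<Rightarrow> real^'d \<Rightarrow> real^'d^'n"
    and f :: "real \<Rightarrow> real^'n \<Rightarrow> real \<Rightarrow> real^'d \<Rightarrow> 'u \<Rightarrow> real"
    and \<phi> :: "real \<Rightarrow> real^'n \<Rightarrow> real"
  assumes T_pos: "T > 0"
    and U: "compact U" "U \<noteq> {}"
    and G_full_rank: "rank G = 1"
    and b_cont: "\<And>x y z. continuous_on ({0..T} \<times> U) (\<lambda>(t, u). b t x y z u)"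
    and f_cont: "\<And>x y z. continuous_on ({0..T} \<times> U) (\<lambda>(t, u). f t x y z u)"
    and \<sigma>_cont: "\<And>x y z. continuous_on {0..T} (\<lambda>s. \<sigma> s x y z)"
    and K_nonneg: "K \<ge> 0"
    and b_Lip: "\<And>s x x' y y' z z' u. s \<in> {0..T} \<Longrightarrow> u \<in> U \<Longrightarrow>
      norm (b s x y z u - b s x' y' z' u) \<le> K * (norm (x - x') + \<bar>y - y'\<bar> + norm (z - z'))"
    and \<sigma>_Lip: "\<And>s x x' y y' z z'. s \<in> {0..T} \<Longrightarrow>
      norm (\<sigma> s x y z - \<sigma> s x' y' z') \<le> K * (norm (x - x') + \<bar>y - y'\<bar> + norm (z - z'))"
    and f_Lip: "\<And>s x x' y y' z z' u. s \<in> {0..T} \<Longrightarrow> u \<in> U \<Longrightarrow>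
      \<bar>f s x y z u - f s x' y' z' u\<bar> \<le> K * (norm (x - x') + \<bar>y - y'\<bar> + norm (z - z'))"
    and \<beta>\<^sub>1_nonneg: "\<beta>\<^sub>1 \<ge> 0"
    and \<beta>\<^sub>2_pos: "\<beta>\<^sub>2 > 0"
    and monotone: "\<And>s u x x' y y' z z'. s \<in> {0..T} \<Longrightarrow> u \<in> U \<Longrightarrow>
      (monotonicity_map G b \<sigma> f s (x, y, z) u - monotonicity_map G b \<sigma> f s (x', y', z') u)
          \<bullet> ((x, y, z) - (x', y', z'))
        \<le> - \<beta>\<^sub>1 * (norm (G *v (x - x')))\<^sup>2
          - \<beta>\<^sub>2 * ((norm (transpose G *v vec (y - y')))\<^sup>2
                 + (norm (transpose G ** (vec (z - z') :: real^'d^1)))\<^sup>2)"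
    and unif_cont_time: "\<And>s. s \<in> {0..T} \<Longrightarrow>
      uniform_limit UNIV (\<lambda>r (x, y, z). G ** \<sigma> r x y z) (\<lambda>(x, y, z). G ** \<sigma> s x y z)
        (at s within {0..T})"
    and \<phi>_C3: "C3_lb_on ({0..T} \<times> UNIV) (\<lambda>(s, x). \<phi> s x)"
    and \<phi>_mono: "\<And>s x x'. s \<in> {0..T} \<Longrightarrow> (\<phi> s x - \<phi> s x') * (G *v (x - x')) $ 1 \<ge> 0"
  shows "(\<forall>s\<in>{0..T}. \<forall>\<zeta> y x. \<exists>!z.
            z = \<zeta> + spatial_gradient \<phi> s x v* \<sigma> s x (y + \<phi> s x) z) \<and>
         (\<exists>h :: real \<Rightarrow> real^'n \<Rightarrow> real \<Rightarrow> real^'d \<Rightarrow> real^'d.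
            (\<forall>s\<in>{0..T}. \<forall>x y \<zeta>.
               h s x y \<zeta> = \<zeta> + spatial_gradient \<phi> s x v* \<sigma> s x (y + \<phi> s x) (h s x y \<zeta>)) \<and>
            (\<exists>L. \<forall>s\<in>{0..T}. \<forall>x. L-lipschitz_on UNIV (\<lambda>(y, \<zeta>). h s x y \<zeta>)) \<and>
            (\<exists>C. \<forall>s\<in>{0..T}. \<forall>x y \<zeta>.
               norm (h s x y \<zeta>) \<le> C * (1 + norm x + \<bar>y\<bar> + norm \<zeta>)) \<and>
            (\<forall>x y \<zeta>. continuous_on {0..T} (\<lambda>s. h s x y \<zeta>)))"
proof -
  let ?g = "G $ 1"
  let ?p = "spatial_gradient \<phi>"
  have "?g \<noteq> 0"
  proof
    assume "?g = 0"
    then have "G = 0"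
      by (simp add: vec_eq_iff forall_1)
    then show False
      using G_full_rank by simp
  qed
  obtain B where "B \<ge> 0"
    and der: "\<And>s x. s \<in> {0..T} \<Longrightarrow> (\<phi> s has_derivative (\<lambda>v. ?p s x \<bullet> v)) (at x)"
    and grad_bound: "\<And>s x. s \<in> {0..T} \<Longrightarrow> norm (?p s x) \<le> B"
    and growth: "\<And>s x. s \<in> {0..T} \<Longrightarrow> \<bar>\<phi> s x\<bar> \<le> \<bar>\<phi> 0 0\<bar> + B * (T + norm x)"
    and cont_\<phi>: "\<And>x. continuous_on {0..T} (\<lambda>s. \<phi> s x)"
    and cont_grad: "\<And>x. continuous_on {0..T} (\<lambda>s. ?p s x)"
    using C3_lb_on_spatial_gradient[OF \<phi>_C3] by blast

  have grad_parallel: "\<exists>\<alpha>\<ge>0. ?p s x = \<alpha> *\<^sub>R ?g" if "s \<in> {0..T}" for s x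
  proof -
    have "(\<phi> s x' - \<phi> s x) * (?g \<bullet> (x' - x)) \<ge> 0" for x'
      using \<phi>_mono[OF that, of x' x]
      by (simp add: matrix_vector_mult_def inner_vec_def)
    from derivative_parallel_if_monotone_along[OF der[OF that] this \<open>?g \<noteq> 0\<close>]
    obtain \<alpha> where "\<alpha> \<ge> 0" "\<And>v. ?p s x \<bullet> v = (\<alpha> *\<^sub>R ?g) \<bullet> v"
      by (metis inner_scaleR_left)
    then show ?thesis
      by (metis vector_eq_rdot)
  qed

  define N where "N s x y z = ?p s x v* \<sigma> s x (y + \<phi> s x) z" for s x y z

  have N_dissipative: "(N s x y z - N s x y z') \<bullet> (z - z') \<le> 0" if s: "s \<in> {0..T}" for s x y z z'
  proof -
    obtain u where "u \<in> U"
      using U(2) by blast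
    let ?Y = "y + \<phi> s x"
    have "(?g v* \<sigma> s x ?Y z - ?g v* \<sigma> s x ?Y z') \<bullet> (z - z')
        \<le> - \<beta>\<^sub>2 * (norm (transpose G ** (vec (z - z') :: real^'d^1)))\<^sup>2"
      using monotone[OF s \<open>u \<in> U\<close>, of x ?Y z x ?Y z']
      by (simp add: monotonicity_map_def matrix_matrix_mult_row vec_eq_iff)
    also have "\<dots> \<le> 0"
      using \<beta>\<^sub>2_pos by simp
    finally have *: "(?g v* \<sigma> s x ?Y z - ?g v* \<sigma> s x ?Y z') \<bullet> (z - z') \<le> 0" .
    obtain \<alpha> where "\<alpha> \<ge> 0" "?p s x = \<alpha> *\<^sub>R ?g"
      using grad_parallel[OF s] by blast
    then have "(N s x y z - N s x y z') \<bullet> (z - z')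
        = \<alpha> * ((?g v* \<sigma> s x ?Y z - ?g v* \<sigma> s x ?Y z') \<bullet> (z - z'))"
      by (simp add: N_def scaleR_vector_matrix_assoc scaleR_diff_right[symmetric])
    then show ?thesis
      using * \<open>\<alpha> \<ge> 0\<close> by (simp add: mult_nonneg_nonpos)
  qed

  have N_lipschitz: "norm (N s x y z - N s x y' z') \<le> B * K * (\<bar>y - y'\<bar> + norm (z - z'))"
    if "s \<in> {0..T}" for s x y y' z z'
  proof -
    have "norm (N s x y z - N s x y' z')
        = norm (?p s x v* (\<sigma> s x (y + \<phi> s x) z - \<sigma> s x (y' + \<phi> s x) z'))"
      by (simp add: N_def vector_matrix_mult_diff_rdistrib)
    also have "\<dots> \<le> norm (?p s x) * norm (\<sigma> s x (y + \<phi> s x) z - \<sigma> s x (y' + \<phi> s x) z')"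
      by (rule norm_vector_matrix_mult_le)
    also have "\<dots> \<le> B * (K * (\<bar>y - y'\<bar> + norm (z - z')))"
      using \<sigma>_Lip[OF that, of x "y + \<phi> s x" z x "y' + \<phi> s x" z'] grad_bound[OF that] \<open>B \<ge> 0\<close>
      by (intro mult_mono) auto
    finally show ?thesis
      by (simp add: mult.assoc)
  qed

  have N_expansive: "norm (z - z') \<le> norm ((z - N s x y z) - (z' - N s x y z'))"
    if "s \<in> {0..T}" for s x y z z'
    using norm_le_norm_diff_if_inner_nonpos[OF N_dissipative[OF that, of x y z z']]
    by (simp add: algebra_simps)

  have unique: "\<exists>!z. z = \<zeta> + N s x y z" if "s \<in> {0..T}" for s x y \<zeta>
  proof (rule dissipative_lipschitz_unique_fixpoint)
    show "(N s x y z - N s x y z') \<bullet> (z - z') \<le> 0" for z z'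
      by (rule N_dissipative[OF that])
    show "norm (N s x y z - N s x y z') \<le> B * K * norm (z - z')" for z z'
      using N_lipschitz[OF that, of x y z y z'] by simp
    show "B * K \<ge> 0"
      using \<open>B \<ge> 0\<close> K_nonneg by simp
  qed

  define h where "h s x y \<zeta> = (THE z. z = \<zeta> + N s x y z)" for s x y \<zeta>
  have h: "h s x y \<zeta> = \<zeta> + N s x y (h s x y \<zeta>)" if "s \<in> {0..T}" for s x y \<zeta>
    unfolding h_def by (rule theI'[OF unique[OF that]])
  then have h_diff: "h s x y \<zeta> - N s x y (h s x y \<zeta>) = \<zeta>" if "s \<in> {0..T}" for s x y \<zeta>
    unfolding diff_eq_eq using that .

  \<comment> \<open>The distance of any \<open>z\<close> from the solution is at most the defect of \<open>z\<close> in the equation.\<close>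
  have h_dist: "norm (h s x y \<zeta> - z) \<le> norm (\<zeta> + N s x y z - z)" if "s \<in> {0..T}" for s x y \<zeta> z
    using N_expansive[OF that, of "h s x y \<zeta>" z x y] unfolding h_diff[OF that]
    by (simp add: algebra_simps)

  have h_lipschitz: "(1 + B * K)-lipschitz_on UNIV (\<lambda>(y, \<zeta>). h s x y \<zeta>)"
    if "s \<in> {0..T}" for s x
  proof (rule lipschitz_onI)
    fix a a' :: "real \<times> (real^'d)"
    obtain y \<zeta> y' \<zeta>' where a: "a = (y, \<zeta>)" "a' = (y', \<zeta>')"
      by (metis surj_pair)
    let ?z' = "h s x y' \<zeta>'"
    have comp: "\<bar>y - y'\<bar> \<le> norm (a - a')" "norm (\<zeta> - \<zeta>') \<le> norm (a - a')"
      using norm_fst_le[of "y - y'" "\<zeta> - \<zeta>'"] norm_snd_le[of "\<zeta> - \<zeta>'" "y - y'"]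
      by (simp_all add: a)
    have "norm (h s x y \<zeta> - ?z') \<le> norm (\<zeta> + N s x y ?z' - ?z')"
      by (rule h_dist[OF that])
    also have "\<zeta> + N s x y ?z' - ?z'
        = (\<zeta> - (?z' - N s x y' ?z')) + (N s x y ?z' - N s x y' ?z')"
      by (simp add: algebra_simps)
    also have "\<dots> = (\<zeta> - \<zeta>') + (N s x y ?z' - N s x y' ?z')"
      by (simp only: h_diff[OF that])
    also have "norm \<dots> \<le> norm (\<zeta> - \<zeta>') + B * K * \<bar>y - y'\<bar>"
      by (rule norm_triangle_le) (use N_lipschitz[OF that, of x y ?z' y' ?z'] in simp)
    also have "\<dots> \<le> norm (a - a') + B * K * norm (a - a')"
      using comp \<open>B \<ge> 0\<close> K_nonneg by (intro add_mono mult_left_mono) auto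
    finally show "dist (case a of (y, \<zeta>) \<Rightarrow> h s x y \<zeta>) (case a' of (y, \<zeta>) \<Rightarrow> h s x y \<zeta>)
        \<le> (1 + B * K) * dist a a'"
      by (simp add: a dist_norm algebra_simps)
  qed (use \<open>B \<ge> 0\<close> K_nonneg in simp)

  have "bounded ((\<lambda>s. \<sigma> s 0 0 0) ` {0..T})"
    by (intro compact_imp_bounded compact_continuous_image \<sigma>_cont) simp
  then obtain S where "S > 0" and S: "\<And>s. s \<in> {0..T} \<Longrightarrow> norm (\<sigma> s 0 0 0) \<le> S"
    unfolding bounded_pos by blast
  \<comment> \<open>The defect of \<open>0\<close> is at most \<open>|\<zeta>| + B |\<sigma>(s, x, y + \<phi>(s, x), 0)|\<close>. Here \<open>|\<sigma>|\<close> is at most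
    \<open>S + K (|x| + |y + \<phi>(s, x)|)\<close>, and the inner bracket of \<open>C\<close> bounds the growth of the last factor.\<close>
  define C where "C = 1 + B * (S + K * (1 + \<bar>\<phi> 0 0\<bar> + B * T + 1 + B))"
  have h_growth: "norm (h s x y \<zeta>) \<le> C * (1 + norm x + \<bar>y\<bar> + norm \<zeta>)"
    if "s \<in> {0..T}" for s x y \<zeta>
  proof -
    let ?m = "1 + norm x + \<bar>y\<bar> + norm \<zeta>"
    let ?c = "1 + \<bar>\<phi> 0 0\<bar> + B * T + 1 + B"
    have T: "T \<ge> 0" and m: "?m \<ge> 1"
      using T_pos by simp_all
    have "\<bar>y + \<phi> s x\<bar> \<le> \<bar>y\<bar> + (\<bar>\<phi> 0 0\<bar> + B * T) * 1 + B * norm x"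
      using growth[OF that, of x] by (simp add: algebra_simps)
    also have "\<dots> \<le> ?m + (\<bar>\<phi> 0 0\<bar> + B * T) * ?m + B * ?m"
      using T m \<open>B \<ge> 0\<close> by (intro add_mono mult_left_mono) auto
    finally have "\<bar>y + \<phi> s x\<bar> \<le> ?m + (\<bar>\<phi> 0 0\<bar> + B * T) * ?m + B * ?m" .
    moreover have "norm x \<le> ?m"
      by simp
    ultimately have "norm x + \<bar>y + \<phi> s x\<bar> \<le> ?m + (?m + (\<bar>\<phi> 0 0\<bar> + B * T) * ?m + B * ?m)"
      by (rule add_mono[rotated])
    also have "\<dots> = ?c * ?m"
      by (simp add: algebra_simps)
    finally have Y: "norm x + \<bar>y + \<phi> s x\<bar> \<le> ?c * ?m" .
    have "norm (\<sigma> s x (y + \<phi> s x) 0) \<le> norm (\<sigma> s 0 0 0) + norm (\<sigma> s x (y + \<phi> s x) 0 - \<sigma> s 0 0 0)"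
      by (rule norm_triangle_sub)
    also have "\<dots> \<le> S * 1 + K * (norm x + \<bar>y + \<phi> s x\<bar>)"
      using S[OF that] \<sigma>_Lip[OF that, of x "y + \<phi> s x" 0 0 0 0] by simp
    also have "\<dots> \<le> S * ?m + K * (?c * ?m)"
      using Y m \<open>S > 0\<close> K_nonneg by (intro add_mono mult_left_mono) auto
    finally have \<sigma>0: "norm (\<sigma> s x (y + \<phi> s x) 0) \<le> (S + K * ?c) * ?m"
      by (simp add: algebra_simps)
    have "norm (h s x y \<zeta>) \<le> norm (\<zeta> + N s x y 0)"
      using h_dist[OF that, of x y \<zeta> 0] by simp
    also have "\<dots> \<le> norm \<zeta> + norm (?p s x) * norm (\<sigma> s x (y + \<phi> s x) 0)"
      unfolding N_def by (rule norm_triangle_le) (simp add: norm_vector_matrix_mult_le)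
    also have "\<dots> \<le> ?m + B * ((S + K * ?c) * ?m)"
      using grad_bound[OF that, of x] \<sigma>0 \<open>B \<ge> 0\<close> by (intro add_mono mult_mono) auto
    finally show ?thesis
      by (simp add: C_def algebra_simps)
  qed

  have N_cont: "continuous_on {0..T} (\<lambda>s. N s x y z)" for x y z
  proof -
    have "continuous_on {0..T} (\<lambda>r. \<sigma> r x (y + \<phi> r x) z)"
      unfolding continuous_on_def
    proof
      fix s
      assume s: "s \<in> {0..T}"
      \<comment> \<open>Freeze the third argument at time \<open>s\<close>; the Lipschitz bound controls the error.\<close>
      have "((\<lambda>r. \<phi> r x) \<longlongrightarrow> \<phi> s x) (at s within {0..T})"
        using cont_\<phi>[of x] s by (simp add: continuous_on_def)
      then have "((\<lambda>r. \<phi> r x - \<phi> s x) \<longlongrightarrow> 0) (at s within {0..T})"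
        by (rule LIM_zero)
      then have "((\<lambda>r. K * \<bar>\<phi> r x - \<phi> s x\<bar>) \<longlongrightarrow> 0) (at s within {0..T})"
        by (intro tendsto_mult_right_zero tendsto_rabs_zero)
      moreover have "\<forall>\<^sub>F r in at s within {0..T}.
          norm (\<sigma> r x (y + \<phi> r x) z - \<sigma> r x (y + \<phi> s x) z) \<le> K * \<bar>\<phi> r x - \<phi> s x\<bar>"
        using \<sigma>_Lip[of _ x "y + \<phi> _ x" z x "y + \<phi> s x" z] by (simp add: eventually_at_filter)
      ultimately have "((\<lambda>r. \<sigma> r x (y + \<phi> r x) z - \<sigma> r x (y + \<phi> s x) z) \<longlongrightarrow> 0) (at s within {0..T})"
        by (rule Lim_null_comparison[rotated])
      moreover have "((\<lambda>r. \<sigma> r x (y + \<phi> s x) z) \<longlongrightarrow> \<sigma> s x (y + \<phi> s x) z) (at s within {0..T})"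
        using \<sigma>_cont s by (simp add: continuous_on_def)
      ultimately show "((\<lambda>r. \<sigma> r x (y + \<phi> r x) z) \<longlongrightarrow> \<sigma> s x (y + \<phi> s x) z) (at s within {0..T})"
        using tendsto_add by fastforce
    qed
    then show ?thesis
      unfolding N_def by (intro continuous_on_vector_matrix_mult cont_grad)
  qed

  have h_cont: "continuous_on {0..T} (\<lambda>s. h s x y \<zeta>)" for x y \<zeta>
    unfolding continuous_on_def
  proof
    fix s
    assume s: "s \<in> {0..T}"
    let ?z = "h s x y \<zeta>"
    have "((\<lambda>r. \<zeta> + N r x y ?z - ?z) \<longlongrightarrow> \<zeta> + N s x y ?z - ?z) (at s within {0..T})"
      using N_cont[of x y ?z] s by (intro tendsto_intros) (simp add: continuous_on_def)
    also have "\<zeta> + N s x y ?z - ?z = 0"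
      using h[OF s, of x y \<zeta>, symmetric] by simp
    finally have "((\<lambda>r. norm (\<zeta> + N r x y ?z - ?z)) \<longlongrightarrow> 0) (at s within {0..T})"
      by (rule tendsto_norm_zero)
    moreover have "\<forall>\<^sub>F r in at s within {0..T}. norm (h r x y \<zeta> - ?z) \<le> norm (\<zeta> + N r x y ?z - ?z)"
      using h_dist by (simp add: eventually_at_filter)
    ultimately have "((\<lambda>r. h r x y \<zeta> - ?z) \<longlongrightarrow> 0) (at s within {0..T})"
      by (rule Lim_null_comparison[rotated])
    then show "((\<lambda>r. h r x y \<zeta>) \<longlongrightarrow> ?z) (at s within {0..T})"
      by (rule LIM_zero_cancel)
  qed

  show ?thesis
    unfolding N_def[symmetric]
    by (intro conjI exI[of _ h] exI[of _ "1 + B * K"] exI[of _ C] ballI allI)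
      (fact unique h h_lipschitz h_growth h_cont)+
qed

end
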